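(* Let $\mathcal{E}$ be an error basis on $\mathfrak{H}=\mathbb{C}^q$, and let $\mathbf{wt}$ be the weight function associated to a tuple $(\mathrm{wt}_1,\dots,\mathrm{wt}_n)$ of weight functions $\mathrm{wt}_j:\mathcal{E}^2\to\mathbb{Z}_{\ge0}^k\cup\{\bot\}$. Let $\mathbf{u}=(u_1,\dots,u_k)$ be indeterminates and suppose there exists an algebraic mapping $\Phi(\mathbf{u})=(\Phi_1(\mathbf{u}),\dots,\Phi_k(\mathbf{u}))$ such that for each $j=1,\dots,n$ and all $D,D'\in\mathcal{E}$ $$\Phi(\mathbf{u})^{\mathrm{wt}_j(D,D')}=\frac{1}{q^2}\sum_{E,E'\in\mathcal{E}}\operatorname{Tr}(E^\dagger D E'(D')^\dagger)\,\mathbf{u}^{\mathrm{wt}_j(E,E')}.$$ Then for all Hermitian operators $M_1,M_2$ on $\mathfrak{H}^{\otimes n}$ the enumerators for this weight function satisfy $$B(\mathbf{u};M_1,M_2)=A(\Phi(\mathbf{u});M_1,M_2).$$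
   Context: An error basis on $\mathfrak{H}=\mathbb{C}^q$ is a set $\mathcal{E}$ of unitary operators containing $I$ that is a basis of $L(\mathfrak{H})$ (so $|\mathcal{E}|=q^2$), with $\operatorname{Tr}(EF^\dagger)=0$ for $E\neq F$, and such that $EF=\omega(E,F)FE$ for all $E,F\in\mathcal{E}$, with scalars $\omega(E,F)\in\mathbb{C}$ satisfying $\omega(E,F)^r=1$ for some fixed $r$. Put $\mathcal{E}^n=\{E_1\otimes\cdots\otimes E_n: E_i\in\mathcal{E}\}$. A weight function is any function $\mathrm{wt}:\mathcal{E}^2\to\mathbb{Z}_{\ge0}^k\cup\{\bot\}$. Given $(\mathrm{wt}_1,\dots,\mathrm{wt}_n)$, define for $E=E_1\otimes\cdots\otimes E_n$ and $E'=E'_1\otimes\cdots\otimes E'_n$ in $\mathcal{E}^n$: $\mathbf{wt}(E,E')=\mathrm{wt}_1(E_1,E_1')+\cdots+\mathrm{wt}_n(E_n,E_n')$, where $t+\bot=\bot+t=\bot$ for every $t$. For a $k$-tuple $\mathbf{v}=(v_1,\dots,v_k)$ of commuting quantities and $t\in\mathbb{Z}_{\ge0}^k$, $\mathbf{v}^t=\prod_i v_i^{t_i}$, and $\mathbf{v}^{\bot}=0$. "Algebraic mapping" means that each $\Phi_i(\mathbf{u})$ is an algebraic function of $\mathbf{u}$ (an element of a fixed algebraic closure of $\mathbb{C}(\mathbf{u})$, for instance a polynomial in $\mathbf{u}$). The enumerators are $$A(\mathbf{u};M_1,M_2)=\sum_{E,E'\in\mathcal{E}^n}\operatorname{Tr}(E^\dagger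 M_1)\operatorname{Tr}(E'M_2)\,\mathbf{u}^{\mathbf{wt}(E,E')},\qquad B(\mathbf{u};M_1,M_2)=\sum_{E,E'\in\mathcal{E}^n}\operatorname{Tr}(E^\dagger M_1E'M_2)\,\mathbf{u}^{\mathbf{wt}(E,E')},$$ and $A(\Phi(\mathbf{u});M_1,M_2)$ is obtained by substituting $u_i\mapsto\Phi_i(\mathbf{u})$. *)

theory Defs
  imports
    "HOL-Analysis.Analysis"
    "HOL-Library.Poly_Mapping"
    "HOL-Computational_Algebra.Fraction_Field"
    "HOL-Algebra.Algebraic_Closure_Type"
begin

section \<open>Operators\<close>

text \<open>
  Operators on \<open>\<complex>\<^sup>q\<close> are matrices indexed by a finite type \<open>'q\<close> with \<open>q = CARD('q)\<close>.  The tensor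
  power of \<open>\<complex>\<^sup>q\<close> with factors indexed by \<open>'n\<close> has the standard basis indexed by \<open>'n \<Rightarrow> 'q\<close>.
\<close>

type_synonym 'i cop = "complex ^ 'i ^ 'i"

text \<open>The library's \<open>*s\<close> on a matrix would multiply its rows by a vector, not its entries by a scalar.\<close>

definition cscale :: "complex \<Rightarrow> 'i::finite cop \<Rightarrow> 'i cop" where
  "cscale c M = (\<chi> i j. c * M $ i $ j)"

interpretation cop: vector_space cscale
  by unfold_locales (simp_all add: cscale_def vec_eq_iff algebra_simps)

definition adjoint_op :: "'i::finite cop \<Rightarrow> 'i cop" where
  "adjoint_op M = (\<chi> i j. cnj (M $ j $ i))"

definition unitary_op :: "'i::finite cop \<Rightarrow> bool" where
  "unitary_op M \<longleftrightarrow> M ** adjoint_op M = mat 1 \<and> adjoint_op M ** M = mat 1"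

definition hermitian_op :: "'i::finite cop \<Rightarrow> bool" where
  "hermitian_op M \<longleftrightarrow> adjoint_op M = M"

definition tensor_op :: "('n::finite \<Rightarrow> 'q::finite cop) \<Rightarrow> ('n \<Rightarrow> 'q) cop" where
  "tensor_op F = (\<chi> a b. \<Prod>i\<in>UNIV. F i $ a i $ b i)"

section \<open>Error bases\<close>

definition error_basis :: "'q::finite cop set \<Rightarrow> bool" where
  "error_basis \<E> \<longleftrightarrow>
     (\<forall>E\<in>\<E>. unitary_op E) \<and>
     mat 1 \<in> \<E> \<and>
     cop.independent \<E> \<and> cop.span \<E> = UNIV \<and>
     (\<forall>E\<in>\<E>. \<forall>F\<in>\<E>. E \<noteq> F \<longrightarrow> trace (E ** adjoint_op F) = 0) \<and>
     (\<exists>r::nat. r > 0 \<and> (\<exists>\<omega>. \<forall>E\<in>\<E>. \<forall>F\<in>\<E>.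
        E ** F = cscale (\<omega> E F) (F ** E) \<and> \<omega> E F ^ r = 1))"

definition error_tuples :: "'q::finite cop set \<Rightarrow> ('n::finite \<Rightarrow> 'q cop) set" where
  "error_tuples \<E> = {F. \<forall>i. F i \<in> \<E>}"

definition error_power :: "'q::finite cop set \<Rightarrow> ('n::finite \<Rightarrow> 'q) cop set" where
  "error_power \<E> = tensor_op ` error_tuples \<E>"

text \<open>
  The factors of an element of \<open>error_power \<E>\<close>; they are unique for an error basis, see
  \<open>inj_on_tensor_op\<close> below.
\<close>

definition tensor_factors :: "'q::finite cop set \<Rightarrow> ('n::finite \<Rightarrow> 'q) cop \<Rightarrow> 'n \<Rightarrow> 'q cop" where
  "tensor_factors \<E> = inv_into (error_tuples \<E>) tensor_op"

lemma trace_tensor_op_adjoint: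
  fixes F G :: "'n::finite \<Rightarrow> 'q::finite cop"
  shows "trace (tensor_op F ** adjoint_op (tensor_op G)) = (\<Prod>i\<in>UNIV. trace (F i ** adjoint_op (G i)))"
proof -
  have ds: "(\<Prod>i\<in>UNIV. \<Sum>x\<in>UNIV. h i x) = (\<Sum>a\<in>UNIV. \<Prod>i\<in>UNIV. h i (a i))"
    for h :: "'n \<Rightarrow> 'q \<Rightarrow> complex"
    using prod_sum_PiE[of "UNIV::'n set" "\<lambda>_. UNIV::'q set" h] by (simp add: PiE_UNIV_domain)
  show ?thesis
    by (simp add: trace_def matrix_matrix_mult_def tensor_op_def adjoint_op_def ds prod.distrib)
qed

lemma inj_on_tensor_op:
  fixes \<E> :: "'q::finite cop set"
  assumes "error_basis \<E>"
  shows "inj_on (tensor_op :: ('n::finite \<Rightarrow> 'q cop) \<Rightarrow> _) (error_tuples \<E>)"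
proof (rule inj_onI, rule ext, rule ccontr)
  fix F G :: "'n \<Rightarrow> 'q cop" and j
  assume FG: "F \<in> error_tuples \<E>" "G \<in> error_tuples \<E>" "tensor_op F = tensor_op G" "F j \<noteq> G j"
  have "trace (tensor_op F ** adjoint_op (tensor_op G)) = 0"
    using FG assms unfolding trace_tensor_op_adjoint
    by (auto simp: error_tuples_def error_basis_def intro!: exI[of _ j])
  moreover have "trace (F i ** adjoint_op (F i)) \<noteq> 0" for i
    using FG(1) assms by (simp add: error_tuples_def error_basis_def unitary_op_def trace_I)
  ultimately show False
    using FG(3) trace_tensor_op_adjoint[of F F] by simp
qed

section \<open>Weights\<close>

datatype 'k wt_val = Wt "nat ^ 'k" | Bot

instantiation wt_val :: (finite) comm_monoid_add
begin

definition zero_wt_val :: "'a wt_val" where "zero_wt_val = Wt 0"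

definition plus_wt_val :: "'a wt_val \<Rightarrow> 'a wt_val \<Rightarrow> 'a wt_val" where
  "plus_wt_val s t = (case s of Wt a \<Rightarrow> (case t of Wt b \<Rightarrow> Wt (a + b) | Bot \<Rightarrow> Bot) | Bot \<Rightarrow> Bot)"

instance
  by standard (auto simp: plus_wt_val_def zero_wt_val_def add_ac split: wt_val.splits)

end

definition wt_power :: "('k::finite \<Rightarrow> 'a::comm_semiring_1) \<Rightarrow> 'k wt_val \<Rightarrow> 'a" where
  "wt_power v t = (case t of Wt a \<Rightarrow> (\<Prod>i\<in>UNIV. v i ^ (a $ i)) | Bot \<Rightarrow> 0)"

type_synonym ('q, 'k) weight_fun = "'q cop \<Rightarrow> 'q cop \<Rightarrow> 'k wt_val"

definition total_wt ::
  "'q::finite cop set \<Rightarrow> ('n::finite \<Rightarrow> ('q, 'k::finite) weight_fun) \<Rightarrow> ('n \<Rightarrow> 'q, 'k) weight_fun" where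
  "total_wt \<E> wt E E' = (\<Sum>j\<in>UNIV. wt j (tensor_factors \<E> E j) (tensor_factors \<E> E' j))"

lemma total_wt_tensor_op:
  fixes F F' :: "'n::finite \<Rightarrow> 'q::finite cop"
  assumes "error_basis \<E>" "F \<in> error_tuples \<E>" "F' \<in> error_tuples \<E>"
  shows "total_wt \<E> wt (tensor_op F) (tensor_op F') = (\<Sum>j\<in>UNIV. wt j (F j) (F' j))"
  using assms by (simp add: total_wt_def tensor_factors_def inj_on_tensor_op inv_into_f_f)

section \<open>Algebraic functions of \<open>u\<close>\<close>

text \<open>
  \<open>('k \<Rightarrow>\<^sub>0 nat) \<Rightarrow>\<^sub>0 complex\<close> is the polynomial ring in indeterminates indexed by \<open>'k\<close>, so
  \<open>'k algfun\<close> is the algebraic closure of \<open>\<complex>(u)\<close>.  The order on \<open>'k\<close> only serves the library's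
  proof that this ring is an integral domain.
\<close>

type_synonym 'k algfun = "((('k \<Rightarrow>\<^sub>0 nat) \<Rightarrow>\<^sub>0 complex) fract) alg_closure"

definition const_fun :: "complex \<Rightarrow> 'k::linorder algfun" where
  "const_fun c = to_ac (Fract (Poly_Mapping.single 0 c) 1)"

definition indet :: "'k::linorder \<Rightarrow> 'k algfun" where
  "indet i = to_ac (Fract (Poly_Mapping.single (Poly_Mapping.single i 1) 1) 1)"

section \<open>Enumerators\<close>

text \<open>The first argument is the tuple that is substituted for \<open>u\<close>.\<close>

definition enum_A ::
  "('k \<Rightarrow> 'k::{finite,linorder} algfun) \<Rightarrow> 'q::finite cop set \<Rightarrow> ('n::finite \<Rightarrow> ('q, 'k) weight_fun) \<Rightarrow>
    ('n \<Rightarrow> 'q) cop \<Rightarrow> ('n \<Rightarrow> 'q) cop \<Rightarrow> 'k algfun" where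
  "enum_A v \<E> wt M1 M2 = (\<Sum>E\<in>error_power \<E>. \<Sum>E'\<in>error_power \<E>.
     const_fun (trace (adjoint_op E ** M1) * trace (E' ** M2)) * wt_power v (total_wt \<E> wt E E'))"

definition enum_B ::
  "('k \<Rightarrow> 'k::{finite,linorder} algfun) \<Rightarrow> 'q::finite cop set \<Rightarrow> ('n::finite \<Rightarrow> ('q, 'k) weight_fun) \<Rightarrow>
    ('n \<Rightarrow> 'q) cop \<Rightarrow> ('n \<Rightarrow> 'q) cop \<Rightarrow> 'k algfun" where
  "enum_B v \<E> wt M1 M2 = (\<Sum>E\<in>error_power \<E>. \<Sum>E'\<in>error_power \<E>.
     const_fun (trace (adjoint_op E ** M1 ** E' ** M2)) * wt_power v (total_wt \<E> wt E E'))"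

end

theory Submission
  imports Defs
begin

text \<open>
  An error basis is an orthogonal basis of unitaries, so each operator \<open>M\<close> on \<open>\<complex>\<^sup>q\<close> is
  \<open>(1/q) \<Sum>\<^sub>D Tr(D\<^sup>\<dagger> M) D\<close>.  Read entrywise this is a completeness relation that multiplies over
  tensor factors, which gives the expansion on the tensor power.  The hypothesis on \<open>\<Phi>\<close> multiplies
  over tensor factors too; inserting it in \<open>A\<close> and exchanging sums leaves, as the coefficient of
  the weight monomial of \<open>(E, E')\<close>, the expansion of
  \<open>Tr(E\<^sup>\<dagger> M\<^sub>1 E' M\<^sub>2)\<close> with respect to both \<open>M\<^sub>1\<close> and \<open>M\<^sub>2\<close>.
\<close>

section \<open>Constants and weight powers\<close>

lemma const_fun_0 [simp]: "const_fun 0 = 0"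
  by (simp add: const_fun_def flip: Zero_fract_def)

lemma const_fun_1 [simp]: "const_fun 1 = 1"
  by (simp add: const_fun_def flip: One_fract_def)

lemma const_fun_add: "const_fun (a + b) = const_fun a + const_fun b"
  by (simp add: const_fun_def single_add flip: to_ac_add)

lemma const_fun_mult: "const_fun (a * b) = const_fun a * const_fun b"
  by (simp add: const_fun_def mult_single flip: to_ac_mult)

lemma const_fun_sum: "const_fun (\<Sum>x\<in>A. f x) = (\<Sum>x\<in>A. const_fun (f x))"
  by (induction A rule: infinite_finite_induct) (auto simp: const_fun_add)

lemma const_fun_power: "const_fun (a ^ n) = const_fun a ^ n"
  by (induction n) (auto simp: const_fun_mult)

lemma const_fun_prod: "const_fun (\<Prod>x\<in>A. f x) = (\<Prod>x\<in>A. const_fun (f x))"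
  by (induction A rule: infinite_finite_induct) (auto simp: const_fun_mult)

text \<open>This also covers \<open>Bot\<close>: it absorbs every summand and its power is 0, which
  absorbs every factor.\<close>

lemma wt_power_add: "wt_power v (s + t) = wt_power v s * wt_power v t"
  by (auto simp: wt_power_def plus_wt_val_def power_add prod.distrib split: wt_val.splits)

lemma wt_power_sum: "wt_power v (\<Sum>j\<in>J. w j) = (\<Prod>j\<in>J. wt_power v (w j))"
proof -
  have "wt_power v 0 = 1"
    by (simp add: wt_power_def zero_wt_val_def)
  then show ?thesis
    by (induction J rule: infinite_finite_induct) (auto simp: wt_power_add)
qed

section \<open>Matrices and tensor products\<close>

lemma matrix_mult_sum_left:
  fixes A :: "'a::semiring_1 ^ 'n ^ 'm" and B :: "'s \<Rightarrow> 'a ^ 'p ^ 'n"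
  shows "A ** (\<Sum>x\<in>S. B x) = (\<Sum>x\<in>S. A ** B x)"
  by (induction S rule: infinite_finite_induct) (auto simp: matrix_matrix_mult_def vec_eq_iff distrib_left sum.distrib)

lemma matrix_mult_sum_right:
  fixes A :: "'s \<Rightarrow> 'a::semiring_1 ^ 'n ^ 'm" and B :: "'a ^ 'p ^ 'n"
  shows "(\<Sum>x\<in>S. A x) ** B = (\<Sum>x\<in>S. A x ** B)"
  by (induction S rule: infinite_finite_induct)
    (auto simp: matrix_matrix_mult_def vec_eq_iff distrib_right sum.distrib)

lemma trace_zero_op: "trace (0 :: 'i::finite cop) = 0"
  by (simp add: trace_def)

lemma trace_sum:
  fixes A :: "'s \<Rightarrow> 'i::finite cop"
  shows "trace (\<Sum>x\<in>S. A x) = (\<Sum>x\<in>S. trace (A x))"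
  by (induction S rule: infinite_finite_induct) (auto simp: trace_add trace_zero_op)

lemma cscale_mult_left: "cscale c A ** B = cscale c (A ** B)"
  by (simp add: cscale_def matrix_matrix_mult_def vec_eq_iff sum_distrib_left mult_ac)

lemma cscale_mult_right: "A ** cscale c B = cscale c (A ** B)"
  by (simp add: cscale_def matrix_matrix_mult_def vec_eq_iff sum_distrib_left mult_ac)

lemma trace_cscale: "trace (cscale c A) = c * trace A"
  by (simp add: cscale_def trace_def sum_distrib_left)

text \<open>Distributivity with choice functions collected as in \<open>error_tuples\<close>, so a
  product over tensor factors of sums over \<open>\<E>\<close> becomes one sum over tuples. With
  \<open>UNIV\<close> for \<open>A\<close> it handles matrix indices as well.\<close>

lemma prod_sum_functions:
  fixes h :: "'n::finite \<Rightarrow> 'a \<Rightarrow> 'b::comm_semiring_1"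
  assumes "finite A"
  shows "(\<Prod>i\<in>UNIV. \<Sum>x\<in>A. h i x) = (\<Sum>F\<in>{F. \<forall>i. F i \<in> A}. \<Prod>i\<in>UNIV. h i (F i))"
  using prod_sum_PiE[of "UNIV::'n set" "\<lambda>_. A" h] assms
  by (simp add: PiE_UNIV_domain Pi_def)

lemma tensor_op_mult: "tensor_op F ** tensor_op G = tensor_op (\<lambda>i. F i ** G i)"
  by (simp add: tensor_op_def matrix_matrix_mult_def vec_eq_iff prod_sum_functions prod.distrib)

lemma adjoint_tensor_op: "adjoint_op (tensor_op F) = tensor_op (\<lambda>i. adjoint_op (F i))"
  by (simp add: tensor_op_def adjoint_op_def vec_eq_iff)

lemma trace_tensor_op: "trace (tensor_op F) = (\<Prod>i\<in>UNIV. trace (F i))"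
  by (simp add: tensor_op_def trace_def prod_sum_functions)

section \<open>Completeness of error bases\<close>

text \<open>The matrix units form a finite spanning set, which bounds the size of any independent
  set of operators.\<close>

lemma cop_in_span_units:
  fixes M :: "'i::finite cop"
  shows "M \<in> cop.span (range (\<lambda>(a, b). \<chi> i j. if i = a \<and> j = b then 1 else 0))"
proof -
  let ?e = "\<lambda>p. (\<chi> i j. if i = fst p \<and> j = snd p then 1 else 0) :: 'i cop"
  have "M = (\<Sum>p\<in>UNIV. cscale (M $ fst p $ snd p) (?e p))"
  proof (simp add: vec_eq_iff cscale_def sum_component, intro allI)
    fix i j
    have "(\<Sum>p\<in>UNIV. M $ fst p $ snd p * (if i = fst p \<and> j = snd p then 1 else 0))
        = (\<Sum>p\<in>UNIV. if p = (i, j) then M $ i $ j else 0)"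
      by (intro sum.cong) auto
    then show "M $ i $ j = (\<Sum>p\<in>UNIV. M $ fst p $ snd p * (if i = fst p \<and> j = snd p then 1 else 0))"
      by simp
  qed
  moreover have "\<dots> \<in> cop.span (range ?e)"
    by (intro cop.span_sum cop.span_scale cop.span_base) auto
  ultimately show ?thesis
    by (simp add: case_prod_beta)
qed

lemma finite_error_basis:
  assumes "error_basis (\<E> :: 'q::finite cop set)"
  shows "finite \<E>"
  using cop.independent_span_bound[of "range (\<lambda>(a, b). \<chi> i j. if i = a \<and> j = b then 1 else 0)" \<E>]
    cop_in_span_units assms
  by (auto simp: error_basis_def)

text \<open>Both sides are linear in \<open>M\<close>, so it is enough to look at elements of
  \<open>\<E>\<close>, which span all operators.\<close>

lemma error_basis_expansion:
  fixes \<E> :: "'q::finite cop set"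
  assumes "error_basis \<E>"
  shows "(\<Sum>D\<in>\<E>. cscale (trace (adjoint_op D ** M)) D) = cscale (of_nat CARD('q)) M"
proof -
  have fin: "finite \<E>"
    by (rule finite_error_basis[OF assms])
  have "M \<in> cop.span \<E>"
    using assms by (simp add: error_basis_def)
  then show ?thesis
  proof (induction rule: cop.span_induct_alt)
    case base
    show ?case
      by (simp add: trace_zero_op)
  next
    case (step c x y)
    \<comment> \<open>Cyclicity of the trace brings in the orthogonality relation for
      \<open>D \<noteq> x\<close>; for \<open>D = x\<close> unitarity leaves the trace of the
      identity.\<close>
    have "trace (adjoint_op D ** x) = (if D = x then of_nat CARD('q) else 0)" if "D \<in> \<E>" for D
      using assms step(1) that trace_mul_sym[of x "adjoint_op D"]
      by (auto simp: error_basis_def unitary_op_def trace_I)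
    then have "(\<Sum>D\<in>\<E>. cscale (trace (adjoint_op D ** x)) D)
        = (\<Sum>D\<in>\<E>. if D = x then cscale (of_nat CARD('q)) x else 0)"
      by (intro sum.cong) auto
    also have "\<dots> = cscale (of_nat CARD('q)) x"
      using step(1) fin by simp
    finally have x: "(\<Sum>D\<in>\<E>. cscale (trace (adjoint_op D ** x)) D) = cscale (of_nat CARD('q)) x" .
    have "(\<Sum>D\<in>\<E>. cscale (trace (adjoint_op D ** (cscale c x + y))) D)
        = cscale c (\<Sum>D\<in>\<E>. cscale (trace (adjoint_op D ** x)) D)
          + (\<Sum>D\<in>\<E>. cscale (trace (adjoint_op D ** y)) D)"
      by (simp add: matrix_add_ldistrib cscale_mult_right trace_add trace_cscale
          cop.scale_left_distrib sum.distrib cop.scale_sum_right)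
    then show ?case
      using x step(2) by (simp add: cop.scale_right_distrib mult.commute)
  qed
qed

lemma trace_adjoint_mult:
  fixes D M :: "'i::finite cop"
  shows "trace (adjoint_op D ** M) = (\<Sum>(a, b)\<in>UNIV. cnj (D $ a $ b) * M $ a $ b)"
proof -
  have "trace (adjoint_op D ** M) = (\<Sum>b\<in>UNIV. \<Sum>a\<in>UNIV. cnj (D $ a $ b) * M $ a $ b)"
    by (simp add: trace_def adjoint_op_def matrix_matrix_mult_def)
  also have "\<dots> = (\<Sum>a\<in>UNIV. \<Sum>b\<in>UNIV. cnj (D $ a $ b) * M $ a $ b)"
    by (rule sum.swap)
  finally show ?thesis
    by (simp add: sum.cartesian_product)
qed

text \<open>Entry \<open>(c, d)\<close> of the expansion of the matrix unit at
  \<open>(a, b)\<close>. In this form no operator \<open>M\<close> occurs, so the relation can be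
  multiplied over tensor factors.\<close>

lemma error_basis_complete:
  fixes \<E> :: "'q::finite cop set"
  assumes "error_basis \<E>"
  shows "(\<Sum>D\<in>\<E>. cnj (D $ a $ b) * D $ c $ d) = (if a = c \<and> b = d then of_nat CARD('q) else 0)"
proof -
  let ?e = "(\<chi> i j. if i = a \<and> j = b then 1 else 0) :: 'q cop"
  have "trace (adjoint_op D ** ?e) = cnj (D $ a $ b)" for D
  proof -
    have "trace (adjoint_op D ** ?e) = (\<Sum>p\<in>UNIV. if p = (a, b) then cnj (D $ a $ b) else 0)"
      unfolding trace_adjoint_mult by (intro sum.cong) (auto split: if_splits)
    then show ?thesis
      by simp
  qed
  then show ?thesis
    using arg_cong[OF error_basis_expansion[OF assms, of ?e], of "\<lambda>M. M $ c $ d"]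
    by (auto simp: cscale_def sum_component)
qed

lemma error_tuples_complete:
  fixes \<E> :: "'q::finite cop set" and a b c d :: "'n::finite \<Rightarrow> 'q"
  assumes "error_basis \<E>"
  shows "(\<Sum>F\<in>error_tuples \<E>. cnj (tensor_op F $ a $ b) * tensor_op F $ c $ d)
      = (if a = c \<and> b = d then of_nat CARD('q) ^ CARD('n) else 0)"
proof -
  have "(\<Sum>F\<in>error_tuples \<E>. cnj (tensor_op F $ a $ b) * tensor_op F $ c $ d)
      = (\<Prod>i\<in>UNIV. \<Sum>D\<in>\<E>. cnj (D $ a i $ b i) * D $ c i $ d i)"
    by (simp add: tensor_op_def error_tuples_def prod_sum_functions finite_error_basis[OF assms]
        prod.distrib)
  also have "\<dots> = (if a = c \<and> b = d then of_nat CARD('q) ^ CARD('n) else 0)"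
    \<comment> \<open>A single index where the functions differ makes one factor, hence the product,
      vanish.\<close>
    by (auto simp: error_basis_complete[OF assms] fun_eq_iff)
  finally show ?thesis .
qed

text \<open>An arbitrary \<open>M\<close> need not be a pure tensor, so the one-factor expansion
  does not multiply directly; the entrywise relation does, and is summed here against the entries of
  \<open>M\<close>.\<close>

lemma error_tuples_expansion:
  fixes \<E> :: "'q::finite cop set" and M :: "('n::finite \<Rightarrow> 'q) cop"
  assumes "error_basis \<E>"
  shows "(\<Sum>F\<in>error_tuples \<E>. cscale (trace (adjoint_op (tensor_op F) ** M)) (tensor_op F))
      = cscale (of_nat CARD('q) ^ CARD('n)) M"
proof -
  have "(\<Sum>F\<in>error_tuples \<E>. trace (adjoint_op (tensor_op F) ** M) * tensor_op F $ c $ d)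
      = of_nat CARD('q) ^ CARD('n) * M $ c $ d" (is "?l = ?r") for c d
  proof -
    have "?l = (\<Sum>p\<in>UNIV. M $ fst p $ snd p * (\<Sum>F\<in>error_tuples \<E>.
        cnj (tensor_op F $ fst p $ snd p) * tensor_op F $ c $ d))"
      unfolding trace_adjoint_mult sum_distrib_left sum_distrib_right
      by (subst sum.swap) (simp add: case_prod_beta mult_ac)
    also have "\<dots> = (\<Sum>p\<in>UNIV. if p = (c, d) then ?r else 0)"
      by (intro sum.cong) (auto simp: error_tuples_complete[OF assms])
    finally show ?thesis
      by simp
  qed
  then show ?thesis
    by (simp add: vec_eq_iff cscale_def sum_component)
qed

lemma adjoint_adjoint_op [simp]: "adjoint_op (adjoint_op M) = M"
  by (simp add: adjoint_op_def vec_eq_iff)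

lemma adjoint_op_mult: "adjoint_op (A ** B) = adjoint_op B ** adjoint_op A"
  by (simp add: adjoint_op_def matrix_matrix_mult_def vec_eq_iff mult.commute)

lemma trace_adjoint_op: "trace (adjoint_op M) = cnj (trace M)"
  by (simp add: adjoint_op_def trace_def)

lemma adjoint_op_cscale: "adjoint_op (cscale c M) = cscale (cnj c) (adjoint_op M)"
  by (simp add: adjoint_op_def cscale_def vec_eq_iff)

lemma adjoint_op_sum: "adjoint_op (\<Sum>x\<in>S. A x) = (\<Sum>x\<in>S. adjoint_op (A x))"
  by (simp add: adjoint_op_def vec_eq_iff sum_component)

text \<open>The adjoint of the expansion of \<open>adjoint_op M\<close>. It fits the second trace in
  \<open>enum_A\<close>, where the error operator appears without an adjoint.\<close>

lemma error_tuples_expansion_adjoint: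
  fixes \<E> :: "'q::finite cop set" and M :: "('n::finite \<Rightarrow> 'q) cop"
  assumes "error_basis \<E>"
  shows "(\<Sum>F\<in>error_tuples \<E>. cscale (trace (tensor_op F ** M)) (adjoint_op (tensor_op F)))
      = cscale (of_nat CARD('q) ^ CARD('n)) M"
proof -
  have "cnj (trace (adjoint_op F ** adjoint_op M)) = trace (F ** M)" for F
    by (simp add: trace_mul_sym[of F M] adjoint_op_mult flip: trace_adjoint_op)
  then show ?thesis
    using arg_cong[OF error_tuples_expansion[OF assms, of "adjoint_op M"], of adjoint_op]
    by (simp add: adjoint_op_sum adjoint_op_cscale)
qed

text \<open>The trace is linear in \<open>M1\<close> and in \<open>M2\<close>; expanding each
  contributes a factor q^n, where q is \<open>CARD('q)\<close> and n is
  \<open>CARD('n)\<close>.\<close>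

lemma double_expansion:
  fixes \<E> :: "'q::finite cop set" and M1 M2 A B :: "('n::finite \<Rightarrow> 'q) cop"
  assumes "error_basis \<E>"
  shows "(\<Sum>G\<in>error_tuples \<E>. \<Sum>G'\<in>error_tuples \<E>.
        trace (adjoint_op (tensor_op G) ** M1) * trace (tensor_op G' ** M2) *
        trace (A ** tensor_op G ** B ** adjoint_op (tensor_op G')))
      = (of_nat CARD('q) ^ 2) ^ CARD('n) * trace (A ** M1 ** B ** M2)" (is "?l = ?r")
proof -
  let ?Q = "of_nat CARD('q) ^ CARD('n) :: complex"
  have "?r = trace (A ** cscale ?Q M1 ** B ** cscale ?Q M2)"
    by (simp add: cscale_mult_left cscale_mult_right trace_cscale power2_eq_square power_mult_distrib)
  also have "\<dots> = ?l"
    unfolding error_tuples_expansion[OF assms, symmetric, of M1]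
      error_tuples_expansion_adjoint[OF assms, symmetric, of M2]
    \<comment> \<open>The swap makes the sum that expands \<open>M2\<close> the outer one, as it
      arises from distributing the matrix products.\<close>
    by (subst sum.swap)
      (simp add: cscale_mult_left cscale_mult_right trace_cscale trace_sum matrix_mult_sum_left
        matrix_mult_sum_right sum_distrib_left mult_ac)
  finally show ?thesis
    by simp
qed

section \<open>The MacWilliams identity\<close>

lemma sum_swap_pairs:
  "(\<Sum>a\<in>A. \<Sum>b\<in>B. \<Sum>c\<in>C. \<Sum>d\<in>D. f a b c d) = (\<Sum>c\<in>C. \<Sum>d\<in>D. \<Sum>a\<in>A. \<Sum>b\<in>B. f a b c d)"
  using sum.swap[of "\<lambda>p r. f (fst p) (snd p) (fst r) (snd r)" "C \<times> D" "A \<times> B"]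
  by (simp add: sum.cartesian_product')

text \<open>Distinct tuples give distinct tensor products, so no error operator is counted
  twice.\<close>

lemma sum_error_power:
  assumes "error_basis \<E>"
  shows "(\<Sum>E\<in>error_power \<E>. f E) = (\<Sum>F\<in>error_tuples \<E>. f (tensor_op F))"
  unfolding error_power_def by (simp add: sum.reindex inj_on_tensor_op[OF assms])

lemma wt_power_total_wt:
  assumes "error_basis \<E>" "F \<in> error_tuples \<E>" "F' \<in> error_tuples \<E>"
  shows "wt_power v (total_wt \<E> wt (tensor_op F) (tensor_op F')) = (\<Prod>j\<in>UNIV. wt_power v (wt j (F j) (F' j)))"
  by (simp add: total_wt_tensor_op[OF assms] wt_power_sum)

theorem mainTheorem4:
  fixes \<E> :: "'q::finite cop set"
    and wt :: "'n::finite \<Rightarrow> ('q, 'k::{finite,linorder}) weight_fun"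
    and \<Phi> :: "'k \<Rightarrow> 'k algfun"
    and M1 M2 :: "('n \<Rightarrow> 'q) cop"
  assumes "error_basis \<E>"
    and "\<And>j D D'. D \<in> \<E> \<Longrightarrow> D' \<in> \<E> \<Longrightarrow>
           wt_power \<Phi> (wt j D D') =
             const_fun (1 / of_nat (CARD('q)) ^ 2) *
             (\<Sum>E\<in>\<E>. \<Sum>E'\<in>\<E>. const_fun (trace (adjoint_op E ** D ** E' ** adjoint_op D')) *
                wt_power indet (wt j E E'))"
    and "hermitian_op M1" and "hermitian_op M2"
  shows "enum_B indet \<E> wt M1 M2 = enum_A \<Phi> \<E> wt M1 M2"
proof -
  note eb = assms(1)
  have fin: "finite \<E>"
    by (rule finite_error_basis[OF eb])
  let ?T = "error_tuples \<E> :: ('n \<Rightarrow> 'q cop) set"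
  \<comment> \<open>Each tensor factor contributes one 1/q^2 from the hypothesis on
    \<open>\<Phi>\<close>.\<close>
  let ?c = "(1 / of_nat CARD('q) ^ 2) ^ CARD('n) :: complex"
  let ?w = "\<lambda>v F F'. wt_power v (total_wt \<E> wt (tensor_op F) (tensor_op F'))"
  let ?t = "\<lambda>F G F' G'. trace (adjoint_op (tensor_op F) ** tensor_op G ** tensor_op F' ** adjoint_op (tensor_op G'))"
  let ?m = "\<lambda>G G'. trace (adjoint_op (tensor_op G) ** M1) * trace (tensor_op G' ** M2)"
  have t: "?t F G F' G' = (\<Prod>j\<in>UNIV. trace (adjoint_op (F j) ** G j ** F' j ** adjoint_op (G' j)))"
    for F G F' G' :: "'n \<Rightarrow> 'q cop"
    by (simp add: adjoint_tensor_op tensor_op_mult trace_tensor_op)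
  \<comment> \<open>The hypothesis for single factors, multiplied over all \<open>j\<close>;
    \<open>t\<close> reassembles the traces.\<close>
  have \<Phi>: "?w \<Phi> G G' = const_fun ?c * (\<Sum>F\<in>?T. \<Sum>F'\<in>?T. const_fun (?t F G F' G') * ?w indet F F')"
    if G: "G \<in> ?T" "G' \<in> ?T" for G G'
  proof -
    have "?w \<Phi> G G' = (\<Prod>j\<in>UNIV. const_fun (1 / of_nat CARD('q) ^ 2) *
        (\<Sum>E\<in>\<E>. \<Sum>E'\<in>\<E>. const_fun (trace (adjoint_op E ** G j ** E' ** adjoint_op (G' j))) *
                wt_power indet (wt j E E')))"
      unfolding wt_power_total_wt[OF eb G] using G
      by (intro prod.cong refl assms(2)) (auto simp: error_tuples_def)
    also have "\<dots> = const_fun ?c * (\<Sum>F\<in>?T. \<Sum>F'\<in>?T.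
        (\<Prod>j\<in>UNIV. const_fun (trace (adjoint_op (F j) ** G j ** F' j ** adjoint_op (G' j))) *
                wt_power indet (wt j (F j) (F' j))))"
      unfolding prod.distrib prod_sum_functions[OF fin] error_tuples_def[symmetric]
      by (simp add: const_fun_power)
    also have "\<dots> = const_fun ?c * (\<Sum>F\<in>?T. \<Sum>F'\<in>?T. const_fun (?t F G F' G') * ?w indet F F')"
      by (intro arg_cong2[where f = times] sum.cong refl)
        (simp add: t const_fun_prod wt_power_total_wt[OF eb] prod.distrib)
    finally show ?thesis .
  qed
  have "enum_A \<Phi> \<E> wt M1 M2 = (\<Sum>G\<in>?T. \<Sum>G'\<in>?T. const_fun (?m G G') * ?w \<Phi> G G')"
    unfolding enum_A_def sum_error_power[OF eb] ..
  also have "\<dots> = (\<Sum>G\<in>?T. \<Sum>G'\<in>?T. \<Sum>F\<in>?T. \<Sum>F'\<in>?T. const_fun (?c * ?m G G' * ?t F G F' G') * ?w indet F F')"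
    by (intro sum.cong refl) (simp add: \<Phi> sum_distrib_left const_fun_mult mult_ac)
  \<comment> \<open>The monomial depends on \<open>F\<close> and \<open>F'\<close> only, so with the
    sums over \<open>G\<close> and \<open>G'\<close> innermost it factors out.\<close>
  also have "\<dots> = (\<Sum>F\<in>?T. \<Sum>F'\<in>?T. \<Sum>G\<in>?T. \<Sum>G'\<in>?T. const_fun (?c * ?m G G' * ?t F G F' G') * ?w indet F F')"
    by (rule sum_swap_pairs)
  also have "\<dots> = (\<Sum>F\<in>?T. \<Sum>F'\<in>?T.
      const_fun (?c * (\<Sum>G\<in>?T. \<Sum>G'\<in>?T. ?m G G' * ?t F G F' G')) * ?w indet F F')"
    by (simp add: sum_distrib_left sum_distrib_right const_fun_sum mult.assoc)
  also have "\<dots> = enum_B indet \<E> wt M1 M2"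
    \<comment> \<open>The factor (q^2)^n from the two expansions cancels \<open>?c\<close>.\<close>
    unfolding double_expansion[OF eb] enum_B_def sum_error_power[OF eb]
    by (simp add: power_divide)
  finally show ?thesis ..
qed

end
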